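(* Let $r=(r_n)$, $t=(t_n)$ be scalar sequences with $r_n\neq 0$ and $t_n\neq 0$ for all $n\in\mathbb{N}_0$, and let $s=(s_n)$ be a scalar sequence with $s_0\neq 0$. For each $X\in\{l_\infty,c,c_0\}$, the $\alpha$-dual of $X(r,s,t;\Delta)$ is the set $$\Lambda=\Big\{a=(a_n)\in w:\ \sup_{K\in\mathcal{F}}\sum_{n=0}^{\infty}\Big|\sum_{j\in K}\sum_{k=0}^{n-j}(-1)^k\frac{D_k^{(s)}}{t_{k+j}}r_j a_n\Big|<\infty\Big\},$$ where $\mathcal{F}$ is the collection of all nonempty finite subsets of $\mathbb{N}_0$ and the inner sum over $k$ is $0$ when $j>n$.
   Context: $\mathbb{N}_0=\{0,1,2,\dots\}$; $w$ is the space of all real (or all complex) sequences $x=(x_n)_{n\in\mathbb{N}_0}$. $l_\infty$, $c$, $c_0$ are the spaces of bounded, convergent and null sequences; $l_1$ is the space of absolutely summable sequences. $\Delta x_k=x_k-x_{k-1}$ with $x_{-1}=0$. For $X\in\{l_\infty,c,c_0\}$, $$X(r,s,t;\Delta)=\Big\{x\in w:\Big(\frac{1}{r_n}\sum_{k=0}^{n}s_{n-k}t_k\Delta x_k\Big)_{n}\in X\Big\}.$$ The numbers $D_n^{(s)}$ are: $D_0^{(s)}=1/s_0$, and for $n\ge1$, $D_n^{(s)}=s_0^{-(n+1)}\det M_n$, where $M_n$ is the $n\times n$ matrix whose $(i,j)$ entry ($1\le i,j\le n$) is $s_{i-j+1}$ if $i-j+1\ge 0$ and $0$ otherwise. The $\alpha$-dual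 of $U\subset w$ is $U^\alpha=\{a\in w:(a_nu_n)_n\in l_1\text{ for all }u\in U\}$. *)

theory Defs
  imports "HOL-Analysis.Euclidean_Space" "HOL-Library.Extended_Nonnegative_Real" "Jordan_Normal_Form.Determinant"
begin

(* Sequences take values in a type of sort {real_normed_field, euclidean_space}. Both real
   and complex are instances, and up to isomorphism they are the only ones (a commutative
   field that is a finite-dimensional normed real algebra), so this sort stands for
   "the scalars are R or C". *)

definition l_infty :: "(nat \<Rightarrow> 'a::real_normed_vector) set" where
  "l_infty = {x. Bseq x}"

definition c_conv :: "(nat \<Rightarrow> 'a::real_normed_vector) set" where
  "c_conv = {x. convergent x}"

definition c_null :: "(nat \<Rightarrow> 'a::real_normed_vector) set" where
  "c_null = {x. x \<longlonglongrightarrow> 0}"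

definition l_one :: "(nat \<Rightarrow> 'a::real_normed_vector) set" where
  "l_one = {x. summable (\<lambda>n. norm (x n))}"

(* Backward difference, with the convention that the term of index -1 is 0. *)
definition bdiff :: "(nat \<Rightarrow> 'a::ab_group_add) \<Rightarrow> nat \<Rightarrow> 'a" where
  "bdiff x k = (if k = 0 then x 0 else x k - x (k - 1))"

definition mean_diff_space ::
  "(nat \<Rightarrow> 'a::field) \<Rightarrow> (nat \<Rightarrow> 'a) \<Rightarrow> (nat \<Rightarrow> 'a) \<Rightarrow> (nat \<Rightarrow> 'a) set \<Rightarrow> (nat \<Rightarrow> 'a) set" where
  "mean_diff_space r s t X =
     {x. (\<lambda>n. 1 / r n * (\<Sum>k\<le>n. s (n - k) * t k * bdiff x k)) \<in> X}"

(* Matrix indices run from 0, which leaves the entry s_{i-j+1} unchanged; the guard j \<le> i + 1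
   keeps the subtraction on nat from truncating. *)
definition hess_mat :: "(nat \<Rightarrow> 'a::zero) \<Rightarrow> nat \<Rightarrow> 'a mat" where
  "hess_mat s n = mat n n (\<lambda>(i, j). if j \<le> i + 1 then s (i + 1 - j) else 0)"

definition D_num :: "(nat \<Rightarrow> 'a::field) \<Rightarrow> nat \<Rightarrow> 'a" where
  "D_num s n = (if n = 0 then 1 / s 0 else det (hess_mat s n) / s 0 ^ (n + 1))"

definition alpha_dual :: "(nat \<Rightarrow> 'a::real_normed_algebra) set \<Rightarrow> (nat \<Rightarrow> 'a) set" where
  "alpha_dual U = {a. \<forall>u\<in>U. (\<lambda>n. a n * u n) \<in> l_one}"

(* Series and supremum are taken in ennreal, so that a divergent series counts as infinite. *)
definition Lambda_set ::
  "(nat \<Rightarrow> 'a::real_normed_field) \<Rightarrow> (nat \<Rightarrow> 'a) \<Rightarrow> (nat \<Rightarrow> 'a) \<Rightarrow> (nat \<Rightarrow> 'a) set" where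
  "Lambda_set r s t =
     {a. (SUP K\<in>{K. finite K \<and> K \<noteq> {}}. \<Sum>n. ennreal (norm
            (\<Sum>j\<in>K. if j \<le> n
                    then \<Sum>k\<le>n - j. (-1) ^ k * (D_num s k / t (k + j)) * r j * a n
                    else 0))) < \<infinity>}"

end

theory Submission
  imports Defs "HOL-Computational_Algebra.Formal_Power_Series"
begin

text \<open>Write \<open>y\<close> for the transformed sequence
\<open>y n = 1 / r n * (\<Sum>k\<le>n. s (n - k) * t k * bdiff x k)\<close>. Its sum is a Cauchy product, so the
transformation says that the power series with coefficients \<open>t k * bdiff x k\<close>, multiplied by
\<open>S = \<Sum> s k X^k\<close>, is the one with coefficients \<open>r j * y j\<close>. As \<open>s 0 \<noteq> 0\<close>, the series \<open>S\<close> is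
invertible, and its reciprocal has the coefficients \<open>(-1) ^ k * D_num s k\<close>
(\<open>D_num_eq_inverse_coeff\<close>, by Cramer's rule). Dividing by \<open>t k\<close> and summing the differences
recovers \<open>x\<close>, so \<open>x \<mapsto> y\<close> is a bijection of all sequences whose inverse is given by a lower
triangular matrix \<open>inv_kernel r s t\<close>. Hence \<open>a\<close> lies in the alpha-dual exactly when the lower
triangular matrix \<open>c n j = inv_kernel r s t n j * a n\<close> maps \<open>X\<close> into \<open>l_one\<close>.

It remains to see that, for each of the three spaces \<open>X\<close>, this happens exactly when the sums
\<open>\<Sum>n. norm (\<Sum>j\<in>K. c n j)\<close> are bounded over all finite sets \<open>K\<close>. Since
\<open>c_null \<subseteq> X \<subseteq> l_infty\<close>, it is enough to show that boundedness of these sums suffices for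
\<open>l_infty\<close> and is necessary for \<open>c_null\<close>. For sufficiency, a convex function on a cube is largest
at a vertex, and the vertices are the indicator functions of finite sets
(\<open>bounded_subset_sums_imp_l_one\<close>). Necessity is a uniform boundedness statement, and a gliding
hump argument proves it (\<open>null_to_l_one_imp_bounded_subset_sums\<close>): if the sums are unbounded,
there are successive disjoint blocks of indices on which they are as large as one likes, and
weights tending to zero on these blocks define a null sequence that \<open>c\<close> does not map into
\<open>l_one\<close>. The triangular shape of \<open>c\<close> makes the early rows blind to the later blocks.\<close>

section \<open>The numbers D as coefficients of a reciprocal power series\<close>

definition lower_toeplitz :: "nat \<Rightarrow> 'a::zero fps \<Rightarrow> 'a mat" where
  "lower_toeplitz n f = mat n n (\<lambda>(i, j). if j \<le> i then fps_nth f (i - j) else 0)"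

lemma lower_toeplitz_carrier [simp]: "lower_toeplitz n f \<in> carrier_mat n n"
  by (simp add: lower_toeplitz_def)

lemma lower_toeplitz_one: "lower_toeplitz n (1 :: 'a::semiring_1 fps) = 1\<^sub>m n"
  by (rule eq_matI) (auto simp: lower_toeplitz_def)

lemma lower_toeplitz_mult:
  fixes f g :: "'a::comm_semiring_1 fps"
  shows "lower_toeplitz n f * lower_toeplitz n g = lower_toeplitz n (f * g)"
proof (rule eq_matI)
  fix i j assume "i < dim_row (lower_toeplitz n (f * g))" "j < dim_col (lower_toeplitz n (f * g))"
  then have ij: "i < n" "j < n" by (auto simp: lower_toeplitz_def)
  have "(lower_toeplitz n f * lower_toeplitz n g) $$ (i, j)
      = (\<Sum>k\<in>{0..<n}. (if k \<le> i then fps_nth f (i - k) else 0) * (if j \<le> k then fps_nth g (k - j) else 0))"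
    using ij by (auto simp: lower_toeplitz_def scalar_prod_def intro!: sum.cong)
  also have "\<dots> = (\<Sum>k\<in>{j..i}. fps_nth f (i - k) * fps_nth g (k - j))"
    using ij by (intro sum.mono_neutral_cong_right) auto
  also have "\<dots> = (if j \<le> i then fps_nth (f * g) (i - j) else 0)"
  proof (cases "j \<le> i")
    case True
    have "(\<Sum>k\<in>{j..i}. fps_nth f (i - k) * fps_nth g (k - j))
        = (\<Sum>l\<in>{0..i - j}. fps_nth f l * fps_nth g (i - j - l))"
      using True by (intro sum.reindex_bij_witness[of _ "\<lambda>l. i - l" "\<lambda>k. i - k"])
        (auto simp: diff_right_commute)
    then show ?thesis using True by (simp add: fps_mult_nth)
  qed simp
  also have "\<dots> = lower_toeplitz n (f * g) $$ (i, j)"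
    using ij by (simp add: lower_toeplitz_def)
  finally show "(lower_toeplitz n f * lower_toeplitz n g) $$ (i, j) = lower_toeplitz n (f * g) $$ (i, j)" .
qed (auto simp: lower_toeplitz_def)

lemma det_lower_toeplitz: "det (lower_toeplitz n f) = fps_nth f 0 ^ n"
  for f :: "'a::comm_ring_1 fps"
proof -
  have "det (lower_toeplitz n f) = prod_list (diag_mat (lower_toeplitz n f))"
    by (rule det_lower_triangular[where n = n]) (auto simp: lower_toeplitz_def)
  also have "diag_mat (lower_toeplitz n f) = replicate n (fps_nth f 0)"
    by (rule nth_equalityI) (auto simp: diag_mat_def lower_toeplitz_def)
  finally show ?thesis by simp
qed

text \<open>Deleting the first row and the last column of the lower triangular Toeplitz matrix of \<open>s\<close> of
size \<open>n + 1\<close> leaves exactly \<open>hess_mat s n\<close>. So \<open>det (hess_mat s n)\<close> is, up to the sign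
\<open>(-1) ^ n\<close>, the lower left entry of the adjugate. The adjugate is also the determinant
\<open>s 0 ^ (n + 1)\<close> times the inverse matrix, and the inverse is the Toeplitz matrix of the reciprocal
series, because Toeplitz matrices multiply like power series.\<close>

lemma D_num_eq_inverse_coeff:
  fixes s :: "nat \<Rightarrow> 'a::field"
  assumes s0: "s 0 \<noteq> 0"
  shows "(-1) ^ n * D_num s n = fps_nth (inverse (Abs_fps s)) n"
proof (cases "n = 0")
  case True
  then show ?thesis by (simp add: D_num_def field_simps)
next
  case False
  let ?S = "Abs_fps s"
  let ?T = "lower_toeplitz (Suc n) ?S" and ?B = "lower_toeplitz (Suc n) (inverse ?S)"
  have BT: "?B * ?T = 1\<^sub>m (Suc n)"
    using s0 by (simp add: lower_toeplitz_mult inverse_mult_eq_1 lower_toeplitz_one)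
  have adj: "adj_mat ?T \<in> carrier_mat (Suc n) (Suc n)" "?T * adj_mat ?T = det ?T \<cdot>\<^sub>m 1\<^sub>m (Suc n)"
    using adj_mat[of ?T "Suc n"] by simp_all
  have "adj_mat ?T = (?B * ?T) * adj_mat ?T" using BT adj(1) by simp
  also have "\<dots> = ?B * (?T * adj_mat ?T)" using adj(1) by (intro assoc_mult_mat[of _ "Suc n" "Suc n" _ "Suc n" _ "Suc n"]) auto
  also have "\<dots> = det ?T \<cdot>\<^sub>m ?B"
    unfolding adj(2) by (subst mult_smult_distrib[of _ "Suc n" "Suc n" _ "Suc n"])
      (auto simp: right_mult_one_mat[of _ "Suc n" "Suc n"])
  finally have "adj_mat ?T $$ (n, 0) = s 0 ^ Suc n * fps_nth (inverse ?S) n"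
    by (simp add: det_lower_toeplitz) (simp add: lower_toeplitz_def)
  moreover have "adj_mat ?T $$ (n, 0) = (-1) ^ n * det (mat_delete ?T 0 n)"
    by (simp add: adj_mat_def lower_toeplitz_def cofactor_def)
  moreover have "mat_delete ?T 0 n = hess_mat s n"
    by (rule eq_matI) (auto simp: mat_delete_def lower_toeplitz_def hess_mat_def)
  ultimately show ?thesis using s0 False by (simp add: D_num_def field_simps)
qed

section \<open>Inverting the mean of the differences\<close>

definition mean_diff ::
  "(nat \<Rightarrow> 'a::field) \<Rightarrow> (nat \<Rightarrow> 'a) \<Rightarrow> (nat \<Rightarrow> 'a) \<Rightarrow> (nat \<Rightarrow> 'a) \<Rightarrow> nat \<Rightarrow> 'a" where
  "mean_diff r s t x n = 1 / r n * (\<Sum>k\<le>n. s (n - k) * t k * bdiff x k)"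

definition inv_kernel ::
  "(nat \<Rightarrow> 'a::field) \<Rightarrow> (nat \<Rightarrow> 'a) \<Rightarrow> (nat \<Rightarrow> 'a) \<Rightarrow> nat \<Rightarrow> nat \<Rightarrow> 'a" where
  "inv_kernel r s t n j =
     (if j \<le> n then \<Sum>k\<le>n - j. (-1) ^ k * (D_num s k / t (k + j)) * r j else 0)"

lemma bdiff_sum: "bdiff (\<lambda>n. \<Sum>k\<le>n. h k) k = h k"
  by (cases k) (auto simp: bdiff_def)

lemma sum_bdiff: "(\<Sum>k\<le>n. bdiff x k) = x n"
  by (induction n) (auto simp: bdiff_def)

lemma mean_diff_eq_iff:
  assumes r: "\<And>n. r n \<noteq> 0" and s0: "s 0 \<noteq> 0"
  shows "mean_diff r s t x = y \<longleftrightarrow>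
    Abs_fps (\<lambda>k. t k * bdiff x k) = inverse (Abs_fps s) * Abs_fps (\<lambda>j. r j * y j)"
proof -
  have "mean_diff r s t x n = fps_nth (Abs_fps (\<lambda>k. t k * bdiff x k) * Abs_fps s) n / r n" for n
    by (simp add: mean_diff_def fps_mult_nth atLeast0AtMost mult.commute[of "s _"] mult.assoc)
  then have "mean_diff r s t x = y \<longleftrightarrow>
    Abs_fps (\<lambda>k. t k * bdiff x k) * Abs_fps s = Abs_fps (\<lambda>j. r j * y j)"
    using r by (simp add: fun_eq_iff fps_eq_iff nonzero_divide_eq_eq mult.commute[of "r _"])
  also have "\<dots> \<longleftrightarrow>
    Abs_fps (\<lambda>k. t k * bdiff x k) = inverse (Abs_fps s) * Abs_fps (\<lambda>j. r j * y j)"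
  proof -
    have inv: "inverse (Abs_fps s) * Abs_fps s = 1" using s0 by (intro inverse_mult_eq_1) simp
    have "f * Abs_fps s = g \<longleftrightarrow> f = inverse (Abs_fps s) * g" for f g
    proof
      assume "f * Abs_fps s = g"
      then have "inverse (Abs_fps s) * g = (inverse (Abs_fps s) * Abs_fps s) * f"
        by (auto simp: mult_ac)
      then show "f = inverse (Abs_fps s) * g" by (simp add: inv)
    next
      assume "f = inverse (Abs_fps s) * g"
      then have "f * Abs_fps s = (inverse (Abs_fps s) * Abs_fps s) * g"
        by (simp only: mult_ac)
      then show "f * Abs_fps s = g" by (simp add: inv)
    qed
    then show ?thesis .
  qed
  finally show ?thesis .
qed

text \<open>The sequence \<open>x\<close> is found by prescribing its differences, which \<open>mean_diff_eq_iff\<close> determines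
from \<open>y\<close>.\<close>

lemma mean_diff_surj:
  assumes r: "\<And>n. r n \<noteq> 0" and t: "\<And>n. t n \<noteq> 0" and s0: "s 0 \<noteq> 0"
  shows "\<exists>x. mean_diff r s t x = y"
proof -
  define g where "g = inverse (Abs_fps s) * Abs_fps (\<lambda>j. r j * y j)"
  have "mean_diff r s t (\<lambda>n. \<Sum>k\<le>n. fps_nth g k / t k) = y"
    using t by (subst mean_diff_eq_iff[of r s, OF r s0]) (auto simp: bdiff_sum fps_eq_iff g_def)
  then show ?thesis by (rule exI[of "\<lambda>x. mean_diff r s t x = y"])
qed

text \<open>The sum of the differences \<open>bdiff x k = (\<Sum>j\<le>k. ...)\<close> over \<open>k \<le> n\<close> is a sum over the triangle
\<open>j \<le> k \<le> n\<close>; summing over \<open>k\<close> first and shifting \<open>k\<close> by \<open>j\<close> gives the entries of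
\<open>inv_kernel\<close>.\<close>

lemma mean_diff_inverse:
  assumes r: "\<And>n. r n \<noteq> 0" and t: "\<And>n. t n \<noteq> 0" and s0: "s 0 \<noteq> 0"
  shows "x n = (\<Sum>j\<le>n. inv_kernel r s t n j * mean_diff r s t x j)"
proof -
  define y where "y = mean_diff r s t x"
  let ?b = "fps_nth (inverse (Abs_fps s))"
  have "Abs_fps (\<lambda>k. t k * bdiff x k) = inverse (Abs_fps s) * Abs_fps (\<lambda>j. r j * y j)"
    using mean_diff_eq_iff[of r s, OF r s0] y_def by blast
  then have conv: "t k * bdiff x k = (\<Sum>i\<le>k. ?b (k - i) * (r i * y i))" for k
    by (simp add: fps_eq_iff fps_mult_nth atLeast0AtMost mult.commute[of "inverse (Abs_fps s)"]
        mult.commute[of "?b _"])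
  have bd: "bdiff x k = (\<Sum>i\<le>k. ?b (k - i) / t k * r i * y i)" for k
  proof -
    have "bdiff x k = (t k * bdiff x k) / t k" using t[of k] by simp
    also have "\<dots> = (\<Sum>i\<le>k. ?b (k - i) / t k * r i * y i)"
      unfolding conv by (simp add: sum_divide_distrib mult_ac)
    finally show ?thesis .
  qed
  have "x n = (\<Sum>k\<le>n. \<Sum>j\<le>k. ?b (k - j) / t k * r j * y j)"
    unfolding bd[symmetric] by (rule sum_bdiff[symmetric])
  also have "\<dots> = (\<Sum>j\<le>n. \<Sum>k\<in>{j..n}. ?b (k - j) / t k * r j * y j)"
    unfolding sum.Sigma[OF finite_atMost ballI[OF finite_atMost]]
      sum.Sigma[OF finite_atMost ballI[OF finite_atLeastAtMost]]
    by (rule sum.reindex_bij_witness[of _ prod.swap prod.swap]) auto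
  also have "\<dots> = (\<Sum>j\<le>n. inv_kernel r s t n j * y j)"
  proof (rule sum.cong[OF refl])
    fix j assume "j \<in> {..n}"
    then have j: "j \<le> n" by simp
    have "(\<Sum>k\<in>{j..n}. ?b (k - j) / t k * r j * y j) = (\<Sum>k\<le>n - j. ?b k / t (k + j) * r j * y j)"
      using j by (intro sum.reindex_bij_witness[of _ "\<lambda>k. k + j" "\<lambda>k. k - j"]) auto
    also have "\<dots> = inv_kernel r s t n j * y j"
      using j by (simp add: inv_kernel_def D_num_eq_inverse_coeff[of s, OF s0, symmetric] sum_distrib_right)
    finally show "(\<Sum>k\<in>{j..n}. ?b (k - j) / t k * r j * y j) = inv_kernel r s t n j * y j" .
  qed
  finally show ?thesis by (simp add: y_def)
qed

lemma alpha_dual_mean_diff_space: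
  fixes r s t :: "nat \<Rightarrow> 'a::real_normed_field"
  assumes r: "\<And>n. r n \<noteq> 0" and t: "\<And>n. t n \<noteq> 0" and s0: "s 0 \<noteq> 0"
  shows "alpha_dual (mean_diff_space r s t X) =
    {a. \<forall>y\<in>X. (\<lambda>n. \<Sum>j\<le>n. inv_kernel r s t n j * a n * y j) \<in> l_one}"
proof -
  have eq: "(\<lambda>n. a n * x n) = (\<lambda>n. \<Sum>j\<le>n. inv_kernel r s t n j * a n * mean_diff r s t x j)" for a x
    by (subst mean_diff_inverse[of r t s x, OF r t s0]) (auto simp: sum_distrib_left mult_ac)
  have "mean_diff_space r s t X = {x. mean_diff r s t x \<in> X}"
    by (simp add: mean_diff_space_def mean_diff_def[abs_def])
  then have "alpha_dual (mean_diff_space r s t X) =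
      {a. \<forall>x. mean_diff r s t x \<in> X \<longrightarrow> (\<lambda>n. a n * x n) \<in> l_one}"
    by (simp add: alpha_dual_def)
  also have "\<dots> = {a. \<forall>x. mean_diff r s t x \<in> X \<longrightarrow>
      (\<lambda>n. \<Sum>j\<le>n. inv_kernel r s t n j * a n * mean_diff r s t x j) \<in> l_one}"
    by (intro Collect_cong all_cong1 imp_cong[OF refl] arg_cong[where f = "\<lambda>z. z \<in> l_one"]) (rule eq)
  also have "\<dots> = {a. \<forall>y\<in>X. (\<lambda>n. \<Sum>j\<le>n. inv_kernel r s t n j * a n * y j) \<in> l_one}"
  proof (intro Collect_cong iffI ballI allI impI)
    fix a y
    assume "\<forall>x. mean_diff r s t x \<in> X \<longrightarrow>
        (\<lambda>n. \<Sum>j\<le>n. inv_kernel r s t n j * a n * mean_diff r s t x j) \<in> l_one" and "y \<in> X"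
    moreover obtain x where "mean_diff r s t x = y" using mean_diff_surj[of r t s, OF r t s0] by blast
    ultimately show "(\<lambda>n. \<Sum>j\<le>n. inv_kernel r s t n j * a n * y j) \<in> l_one" by blast
  qed blast
  finally show ?thesis .
qed

section \<open>Matrices mapping bounded sequences to absolutely summable ones\<close>

text \<open>Partial sums with a real bound replace the extended nonnegative series and supremum, so that the
estimates below can be made with finite sums of reals. The empty set \<open>K\<close> only adds the value
zero.\<close>

definition bounded_subset_sums :: "(nat \<Rightarrow> nat \<Rightarrow> 'a::real_normed_vector) \<Rightarrow> bool" where
  "bounded_subset_sums c \<longleftrightarrow>
     (\<exists>M. \<forall>K N. finite K \<longrightarrow> (\<Sum>n\<le>N. norm (\<Sum>j\<in>K. c n j)) \<le> M)"

lemma bounded_subset_sums_iff_SUP: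
  "bounded_subset_sums c \<longleftrightarrow>
     (SUP K\<in>{K. finite K \<and> K \<noteq> {}}. \<Sum>n. ennreal (norm (\<Sum>j\<in>K. c n j))) < \<infinity>"
    (is "_ \<longleftrightarrow> ?S < \<infinity>")
proof
  assume "bounded_subset_sums c"
  then obtain M where M: "\<And>K N. finite K \<Longrightarrow> (\<Sum>n\<le>N. norm (\<Sum>j\<in>K. c n j)) \<le> M"
    by (auto simp: bounded_subset_sums_def)
  have "(\<Sum>n. ennreal (norm (\<Sum>j\<in>K. c n j))) \<le> ennreal M" if "finite K" for K
  proof (rule suminf_le_const)
    show "(\<Sum>n<N. ennreal (norm (\<Sum>j\<in>K. c n j))) \<le> ennreal M" for N
    proof (cases N)
      case (Suc N')
      then show ?thesis using M[OF that, of N'] by (simp add: lessThan_Suc_atMost ennreal_leI)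
    qed simp
  qed simp
  then have "?S \<le> ennreal M" by (auto intro: SUP_least)
  then show "?S < \<infinity>" by (simp add: le_less_trans)
next
  assume fin: "?S < \<infinity>"
  have "(\<Sum>n\<le>N. norm (\<Sum>j\<in>K. c n j)) \<le> enn2real ?S" if "finite K" for K N
  proof (cases "K = {}")
    case False
    have "ennreal (\<Sum>n\<le>N. norm (\<Sum>j\<in>K. c n j)) = (\<Sum>n\<le>N. ennreal (norm (\<Sum>j\<in>K. c n j)))"
      by simp
    also have "\<dots> \<le> (\<Sum>n. ennreal (norm (\<Sum>j\<in>K. c n j)))"
      by (intro sum_le_suminf) auto
    also have "\<dots> \<le> ?S" using that False by (intro SUP_upper) auto
    also have "\<dots> = ennreal (enn2real ?S)" using fin by simp
    finally show ?thesis by (simp add: ennreal_le_iff)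
  qed simp
  then show "bounded_subset_sums c" unfolding bounded_subset_sums_def by blast
qed

text \<open>The left side of the conclusion is convex in each \<open>\<mu> j\<close> separately, so each coefficient in
turn can be replaced by one of 0 and 1 without decreasing it; what is left is a subset sum. The offset
\<open>v\<close> collects the vectors whose coefficient has been set to 1, which is what the induction needs.\<close>

lemma convex_combination_bound:
  fixes c :: "nat \<Rightarrow> nat \<Rightarrow> 'a::real_normed_vector"
  assumes "finite A" and "\<And>j. 0 \<le> \<mu> j \<and> \<mu> j \<le> 1"
    and "\<And>K. K \<subseteq> A \<Longrightarrow> (\<Sum>n\<in>I. norm (v n + (\<Sum>j\<in>K. c n j))) \<le> M"
  shows "(\<Sum>n\<in>I. norm (v n + (\<Sum>j\<in>A. \<mu> j *\<^sub>R c n j))) \<le> M"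
  using assms(1,3)
proof (induction A arbitrary: v)
  case empty
  then show ?case by simp
next
  case (insert i A)
  have split: "v n + (\<Sum>j\<in>insert i A. \<mu> j *\<^sub>R c n j)
      = (1 - \<mu> i) *\<^sub>R (v n + (\<Sum>j\<in>A. \<mu> j *\<^sub>R c n j))
        + \<mu> i *\<^sub>R ((v n + c n i) + (\<Sum>j\<in>A. \<mu> j *\<^sub>R c n j))" for n
    using insert.hyps by (simp add: algebra_simps)
  have without: "(\<Sum>n\<in>I. norm (v n + (\<Sum>j\<in>A. \<mu> j *\<^sub>R c n j))) \<le> M"
    by (rule insert.IH) (auto intro: insert.prems)
  have "with": "(\<Sum>n\<in>I. norm ((v n + c n i) + (\<Sum>j\<in>A. \<mu> j *\<^sub>R c n j))) \<le> M"
  proof (rule insert.IH)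
    fix K assume K: "K \<subseteq> A"
    then have "i \<notin> K" "finite K" using insert.hyps finite_subset by auto
    then show "(\<Sum>n\<in>I. norm (v n + c n i + (\<Sum>j\<in>K. c n j))) \<le> M"
      using insert.prems[of "insert i K"] K by (auto simp: add.assoc)
  qed
  have "(\<Sum>n\<in>I. norm (v n + (\<Sum>j\<in>insert i A. \<mu> j *\<^sub>R c n j)))
      \<le> (\<Sum>n\<in>I. (1 - \<mu> i) * norm (v n + (\<Sum>j\<in>A. \<mu> j *\<^sub>R c n j))
          + \<mu> i * norm ((v n + c n i) + (\<Sum>j\<in>A. \<mu> j *\<^sub>R c n j)))"
    unfolding split using assms(2)[of i]
    by (intro sum_mono order.trans[OF norm_triangle_ineq]) simp
  also have "\<dots> \<le> (1 - \<mu> i) * M + \<mu> i * M"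
    unfolding sum.distrib sum_distrib_left[symmetric] using assms(2)[of i] without "with"
    by (intro add_mono mult_left_mono) auto
  finally show ?case by (simp add: algebra_simps)
qed

text \<open>The substitution \<open>\<theta> = 2 * L * \<mu> - L\<close> carries \<open>\<mu>\<close> in \<open>[0, 1]\<close> onto
\<open>\<theta>\<close> in \<open>[-L, L]\<close>. The part with \<open>\<mu>\<close> then costs \<open>2 * L * M\<close> and the constant part \<open>L * M\<close>.\<close>

lemma bounded_subset_sums_real_coeffs:
  fixes c :: "nat \<Rightarrow> nat \<Rightarrow> 'a::real_normed_vector"
  assumes M: "\<And>K. finite K \<Longrightarrow> (\<Sum>n\<in>I. norm (\<Sum>j\<in>K. c n j)) \<le> M"
    and "finite A" and L: "L > 0" "\<And>j. \<bar>\<theta> j\<bar> \<le> L"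
  shows "(\<Sum>n\<in>I. norm (\<Sum>j\<in>A. \<theta> j *\<^sub>R c n j)) \<le> 3 * L * M"
proof -
  define \<mu> where "\<mu> j = (\<theta> j / L + 1) / 2" for j
  have \<mu>: "0 \<le> \<mu> j \<and> \<mu> j \<le> 1" for j
    using L(2)[of j] L(1) by (auto simp: \<mu>_def field_simps abs_le_iff)
  have "\<theta> j = 2 * L * \<mu> j - L" for j using L(1) by (simp add: \<mu>_def field_simps)
  then have eq: "(\<Sum>j\<in>A. \<theta> j *\<^sub>R c n j) = (2 * L) *\<^sub>R (\<Sum>j\<in>A. \<mu> j *\<^sub>R c n j) - L *\<^sub>R (\<Sum>j\<in>A. c n j)" for n
    by (simp add: scaleR_right.sum scaleR_diff_left sum_subtractf)
  have "(\<Sum>n\<in>I. norm (0 + (\<Sum>j\<in>A. \<mu> j *\<^sub>R c n j))) \<le> M"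
    using assms(2) finite_subset by (intro convex_combination_bound \<mu>) (auto intro!: M)
  then have conv: "(\<Sum>n\<in>I. norm (\<Sum>j\<in>A. \<mu> j *\<^sub>R c n j)) \<le> M" by simp
  have "(\<Sum>n\<in>I. norm (\<Sum>j\<in>A. \<theta> j *\<^sub>R c n j))
      \<le> (\<Sum>n\<in>I. 2 * L * norm (\<Sum>j\<in>A. \<mu> j *\<^sub>R c n j) + L * norm (\<Sum>j\<in>A. c n j))"
    unfolding eq using L(1) by (intro sum_mono order.trans[OF norm_triangle_ineq4]) simp
  also have "\<dots> \<le> 2 * L * M + L * M"
    unfolding sum.distrib sum_distrib_left[symmetric] using L(1) conv M[OF assms(2)]
    by (intro add_mono mult_left_mono) auto
  finally show ?thesis by simp
qed

text \<open>Expanding the scalars \<open>y j\<close> in the real basis of the field reduces the claim to bounded real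
coefficients, one family for each basis vector.\<close>

lemma bounded_subset_sums_imp_l_one:
  fixes c :: "nat \<Rightarrow> nat \<Rightarrow> 'a::{real_normed_field, euclidean_space}"
  assumes c: "bounded_subset_sums c" and tri: "\<And>n j. n < j \<Longrightarrow> c n j = 0" and y: "Bseq y"
  shows "(\<lambda>n. \<Sum>j\<le>n. c n j * y j) \<in> l_one"
proof -
  obtain M where M: "\<And>K N. finite K \<Longrightarrow> (\<Sum>n\<le>N. norm (\<Sum>j\<in>K. c n j)) \<le> M"
    using c by (auto simp: bounded_subset_sums_def)
  obtain L where L: "L > 0" "\<And>j. norm (y j) \<le> L" using y by (auto simp: Bseq_def)
  have "(\<Sum>n\<le>N. norm (\<Sum>j\<le>n. c n j * y j)) \<le> real DIM('a) * (3 * L * M)" for N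
  proof -
    have coord: "(\<Sum>j\<le>n. c n j * y j) = (\<Sum>b\<in>Basis. (\<Sum>j\<le>N. inner (y j) b *\<^sub>R c n j) * b)"
      if "n \<le> N" for n
    proof -
      have "(\<Sum>j\<le>n. c n j * y j) = (\<Sum>j\<le>N. c n j * y j)"
        using that tri by (intro sum.mono_neutral_left) auto
      also have "\<dots> = (\<Sum>j\<le>N. c n j * (\<Sum>b\<in>Basis. inner (y j) b *\<^sub>R b))"
        by (simp only: euclidean_representation)
      also have "\<dots> = (\<Sum>j\<le>N. \<Sum>b\<in>Basis. (inner (y j) b *\<^sub>R c n j) * b)"
        by (simp add: sum_distrib_left)
      finally show ?thesis by (subst (asm) sum.swap) (simp only: sum_distrib_right)
    qed
    have "(\<Sum>n\<le>N. norm (\<Sum>j\<le>n. c n j * y j))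
        \<le> (\<Sum>n\<le>N. \<Sum>b\<in>(Basis::'a set). norm (\<Sum>j\<le>N. inner (y j) b *\<^sub>R c n j))"
      by (intro sum_mono) (auto simp: coord norm_mult intro!: order.trans[OF norm_sum] sum_mono)
    also have "\<dots> = (\<Sum>b\<in>(Basis::'a set). \<Sum>n\<le>N. norm (\<Sum>j\<le>N. inner (y j) b *\<^sub>R c n j))"
      by (rule sum.swap)
    also have "\<dots> \<le> (\<Sum>b\<in>(Basis::'a set). 3 * L * M)"
      using L by (intro sum_mono bounded_subset_sums_real_coeffs M)
        (auto intro: order.trans[OF Basis_le_norm])
    finally show ?thesis by simp
  qed
  then show ?thesis unfolding l_one_def mem_Collect_eq
    by (rule bounded_imp_summable[OF norm_ge_zero])
qed

section \<open>The gliding hump\<close>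

text \<open>Each column of \<open>c\<close> is absolutely summable, so the columns up to \<open>m\<close> together
contribute at most a finite amount \<open>T m\<close>, whatever coefficients of norm at most 1 they carry. If
the subset sums are unbounded, they therefore stay unbounded for sets beyond any \<open>m\<close>. This yields
cut points \<open>N 0 < N 1 < ...\<close> and sets \<open>K i \<subseteq> {N i<..N (Suc i)}\<close> whose sums exceed
\<open>(i + 1) * (i + T (N i))\<close>. Let \<open>y\<close> be \<open>1 / (i + 1)\<close> on \<open>K i\<close> and 0 elsewhere. In the rows up to
\<open>N (Suc i)\<close> the blocks after \<open>K i\<close> are invisible by triangularity, the blocks before it amount to
at most \<open>T (N i)\<close>, and \<open>K i\<close> itself gives more than \<open>i + T (N i)\<close>. So the norms of the image of
\<open>y\<close> have partial sums at least \<open>i\<close> for every \<open>i\<close>.\<close>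

lemma null_to_l_one_imp_bounded_subset_sums:
  fixes c :: "nat \<Rightarrow> nat \<Rightarrow> 'a::real_normed_field"
  assumes tri: "\<And>n j. n < j \<Longrightarrow> c n j = 0"
    and l1: "\<And>y. y \<longlonglongrightarrow> 0 \<Longrightarrow> (\<lambda>n. \<Sum>j\<le>n. c n j * y j) \<in> l_one"
  shows "bounded_subset_sums c"
proof (rule ccontr)
  assume unbdd: "\<not> bounded_subset_sums c"
  \<comment> \<open>The image of the unit sequence at \<open>j\<close> is column \<open>j\<close>.\<close>
  have col: "summable (\<lambda>n. norm (c n j))" for j
  proof -
    have "(\<lambda>i. if i = j then 1 else 0 :: 'a) \<longlonglongrightarrow> 0"
      by (rule tendsto_eventually, rule eventually_sequentiallyI[of "Suc j"]) auto
    from l1[OF this] have "summable (\<lambda>n. norm (\<Sum>i\<le>n. c n i * (if i = j then 1 else 0)))"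
      by (simp add: l_one_def)
    moreover have "(\<Sum>i\<le>n. c n i * (if i = j then 1 else 0)) = c n j" for n
      using tri[of n j] by (auto simp: if_distrib cong: if_cong)
    ultimately show ?thesis by simp
  qed
  define T where "T m = (\<Sum>j\<le>m. \<Sum>n. norm (c n j))" for m
  have T: "(\<Sum>n\<le>N. norm (\<Sum>j\<in>K. c n j * z j)) \<le> T m"
    if "K \<subseteq> {..m}" "\<And>j. norm (z j) \<le> 1" for K m N and z :: "nat \<Rightarrow> 'a"
  proof -
    have "norm (\<Sum>j\<in>K. c n j * z j) \<le> (\<Sum>j\<le>m. norm (c n j))" for n
    proof -
      have "norm (\<Sum>j\<in>K. c n j * z j) \<le> (\<Sum>j\<in>K. norm (c n j))"
        using that(2) by (intro order.trans[OF norm_sum] sum_mono)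
          (simp add: norm_mult mult_left_le)
      also have "\<dots> \<le> (\<Sum>j\<le>m. norm (c n j))" using that(1) by (intro sum_mono2) auto
      finally show ?thesis .
    qed
    then have "(\<Sum>n\<le>N. norm (\<Sum>j\<in>K. c n j * z j)) \<le> (\<Sum>n\<le>N. \<Sum>j\<le>m. norm (c n j))"
      by (rule sum_mono)
    also have "\<dots> = (\<Sum>j\<le>m. \<Sum>n\<le>N. norm (c n j))" by (rule sum.swap)
    also have "\<dots> \<le> T m" unfolding T_def by (intro sum_mono sum_le_suminf col) auto
    finally show ?thesis .
  qed
  have hump: "\<exists>K N. m < N \<and> K \<subseteq> {m<..N} \<and> B < (\<Sum>n\<le>N. norm (\<Sum>j\<in>K. c n j))" for m B
  proof -
    obtain K N where K: "finite K" "B + T m < (\<Sum>n\<le>N. norm (\<Sum>j\<in>K. c n j))"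
      using unbdd unfolding bounded_subset_sums_def by (meson not_le)
    \<comment> \<open>Enlarging the range of rows makes the set lie below its end, as the next block must start after it.\<close>
    obtain N' where N': "K \<union> {N, Suc m} \<subseteq> {..N'}"
      using K(1) finite_nat_iff_bounded_le by (metis finite.emptyI finite_UnI finite_insert)
    have eq: "(\<Sum>j\<in>K. c n j) = (\<Sum>j\<in>K \<inter> {..m}. c n j * 1) + (\<Sum>j\<in>K \<inter> {m<..}. c n j)" for n
    proof -
      have "K = (K \<inter> {..m}) \<union> (K \<inter> {m<..})" by auto
      then have "(\<Sum>j\<in>K. c n j) = (\<Sum>j\<in>(K \<inter> {..m}) \<union> (K \<inter> {m<..}). c n j)" by simp
      also have "\<dots> = (\<Sum>j\<in>K \<inter> {..m}. c n j * 1) + (\<Sum>j\<in>K \<inter> {m<..}. c n j)"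
        using K(1) by (subst sum.union_disjoint) auto
      finally show ?thesis .
    qed
    have "B + T m < (\<Sum>n\<le>N'. norm (\<Sum>j\<in>K. c n j))"
      using N' by (intro less_le_trans[OF K(2)] sum_mono2) auto
    also have "\<dots> \<le> (\<Sum>n\<le>N'. norm (\<Sum>j\<in>K \<inter> {..m}. c n j * 1))
        + (\<Sum>n\<le>N'. norm (\<Sum>j\<in>K \<inter> {m<..}. c n j))"
      unfolding eq sum.distrib[symmetric] by (intro sum_mono norm_triangle_ineq)
    also have "\<dots> \<le> T m + (\<Sum>n\<le>N'. norm (\<Sum>j\<in>K \<inter> {m<..}. c n j))"
      by (intro add_right_mono T) auto
    finally have "B < (\<Sum>n\<le>N'. norm (\<Sum>j\<in>K \<inter> {m<..}. c n j))" by simp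
    then show ?thesis using N' by (intro exI[of _ "K \<inter> {m<..}"] exI[of _ N']) auto
  qed
  define good where "good i m N K \<longleftrightarrow> m < N \<and> K \<subseteq> {m<..N} \<and>
      real (Suc i) * (real i + T m) < (\<Sum>n\<le>N. norm (\<Sum>j\<in>K. c n j))" for i m N K
  have "\<exists>N. \<forall>i. True \<and> (\<exists>K. good i (N i) (N (Suc i)) K)"
  proof (rule dependent_nat_choice)
    show "\<exists>N. True \<and> (\<exists>K. good i m N K)" for m :: nat and i
      using hump[of m "real (Suc i) * (real i + T m)"] unfolding good_def by blast
  qed simp
  then obtain N where "\<And>i. \<exists>K. good i (N i) (N (Suc i)) K" by blast
  then obtain K where good: "\<And>i. good i (N i) (N (Suc i)) (K i)" by metis
  have "strict_mono N" using good by (simp add: good_def strict_mono_Suc_iff)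
  then have N_mono: "N i \<le> N l" if "i \<le> l" for i l
    using that by (simp add: strict_mono_less_eq)
  have K_sub: "K i \<subseteq> {N i<..N (Suc i)}" for i using good by (simp add: good_def)
  \<comment> \<open>The intervals between cut points are disjoint, so an index in the \<open>i\<close>-th one can only lie in \<open>K i\<close>.\<close>
  have block: "l = i" if "j \<in> K l" "j \<in> {N i<..N (Suc i)}" for i j l
  proof (rule ccontr)
    assume "l \<noteq> i"
    then consider "Suc l \<le> i" | "Suc i \<le> l" by linarith
    then show False
    proof cases
      case 1
      then show False using N_mono[OF 1] K_sub[of l] that by fastforce
    next
      case 2
      then show False using N_mono[OF 2] K_sub[of l] that by fastforce
    qed
  qed
  define y :: "nat \<Rightarrow> 'a" where
    "y j = (if \<exists>i. j \<in> K i then of_real (1 / real (Suc (SOME i. j \<in> K i))) else 0)" for j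
  have y_in: "y j = of_real (1 / real (Suc i))" if "j \<in> K i" for i j
  proof -
    have "j \<in> {N i<..N (Suc i)}" using that K_sub by blast
    then have "(SOME l. j \<in> K l) = i" using that block by (intro some_equality)
    then show ?thesis using that by (auto simp: y_def)
  qed
  have y_out: "y j = 0" if "\<nexists>i. j \<in> K i" for j using that by (simp add: y_def)
  have y_le1: "norm (y j) \<le> 1" for j
    by (cases "\<exists>i. j \<in> K i") (auto simp: y_in y_out norm_divide simp del: of_nat_Suc)
  have "y \<longlonglongrightarrow> 0"
  proof (rule LIMSEQ_I)
    fix e :: real assume "0 < e"
    then obtain i where i: "1 / real (Suc i) < e" using nat_approx_posE by blast
    have "norm (y j) < e" if "j \<ge> Suc (N i)" for j
    proof (cases "\<exists>l. j \<in> K l")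
      case True
      then obtain l where l: "j \<in> K l" by blast
      have "i \<le> l"
      proof (rule ccontr)
        assume "\<not> i \<le> l"
        then have "N (Suc l) \<le> N i" by (intro N_mono) simp
        then show False using l K_sub[of l] that by fastforce
      qed
      then have "1 / real (Suc l) \<le> 1 / real (Suc i)" by (intro divide_left_mono) auto
      then show ?thesis using i by (simp add: y_in[OF l] norm_divide del: of_nat_Suc)
    qed (use \<open>0 < e\<close> in \<open>simp add: y_out\<close>)
    then show "\<exists>n0. \<forall>j\<ge>n0. norm (y j - 0) < e" by auto
  qed
  then have summ: "summable (\<lambda>n. norm (\<Sum>j\<le>n. c n j * y j))" using l1 by (simp add: l_one_def)
  have "real i \<le> (\<Sum>n. norm (\<Sum>j\<le>n. c n j * y j))" for i
  proof -
    have decomp: "(\<Sum>j\<le>n. c n j * y j)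
        = (\<Sum>j\<in>K i. c n j) * of_real (1 / real (Suc i)) + (\<Sum>j\<le>N i. c n j * y j)"
      if "n \<le> N (Suc i)" for n
    proof -
      have "(\<Sum>j\<le>n. c n j * y j) = (\<Sum>j\<le>N (Suc i). c n j * y j)"
        using that tri by (intro sum.mono_neutral_left) auto
      also have "{..N (Suc i)} = {N i<..N (Suc i)} \<union> {..N i}" using N_mono[of i "Suc i"] by auto
      also have "(\<Sum>j\<in>{N i<..N (Suc i)} \<union> {..N i}. c n j * y j)
          = (\<Sum>j\<in>{N i<..N (Suc i)}. c n j * y j) + (\<Sum>j\<le>N i. c n j * y j)"
        by (rule sum.union_disjoint) auto
      also have "(\<Sum>j\<in>{N i<..N (Suc i)}. c n j * y j) = (\<Sum>j\<in>K i. c n j * of_real (1 / real (Suc i)))"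
      proof (intro sum.mono_neutral_cong_right ballI)
        show "c n j * y j = 0" if "j \<in> {N i<..N (Suc i)} - K i" for j
        proof -
          have "\<nexists>l. j \<in> K l" using that block by blast
          then show ?thesis by (simp add: y_out)
        qed
      qed (use K_sub in \<open>auto simp: y_in\<close>)
      finally show ?thesis by (simp only: sum_distrib_right)
    qed
    have "real i + T (N i) < (\<Sum>n\<le>N (Suc i). norm (\<Sum>j\<in>K i. c n j)) * (1 / real (Suc i))"
      using good[of i] by (simp add: good_def field_simps del: of_nat_Suc)
    also have "\<dots> = (\<Sum>n\<le>N (Suc i). norm ((\<Sum>j\<in>K i. c n j) * of_real (1 / real (Suc i))))"
      unfolding sum_distrib_right[of _ "{..N (Suc i)}"] norm_mult norm_of_real by simp
    also have "\<dots> \<le> (\<Sum>n\<le>N (Suc i). norm (\<Sum>j\<le>n. c n j * y j) + norm (\<Sum>j\<le>N i. c n j * y j))"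
    proof (rule sum_mono)
      fix n assume "n \<in> {..N (Suc i)}"
      then have "(\<Sum>j\<in>K i. c n j) * of_real (1 / real (Suc i))
          = (\<Sum>j\<le>n. c n j * y j) - (\<Sum>j\<le>N i. c n j * y j)" by (simp only: decomp atMost_iff) simp
      then show "norm ((\<Sum>j\<in>K i. c n j) * of_real (1 / real (Suc i)))
          \<le> norm (\<Sum>j\<le>n. c n j * y j) + norm (\<Sum>j\<le>N i. c n j * y j)"
        by (simp only: norm_triangle_ineq4)
    qed
    also have "\<dots> \<le> (\<Sum>n. norm (\<Sum>j\<le>n. c n j * y j)) + T (N i)"
      unfolding sum.distrib using y_le1 by (intro add_mono sum_le_suminf summ T) auto
    finally show ?thesis by simp
  qed
  then show False by (meson reals_Archimedean2 not_le)
qed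

section \<open>The alpha-dual\<close>

theorem theorem4p5:
  fixes r s t :: "nat \<Rightarrow> 'a::{real_normed_field, euclidean_space}"
  assumes "\<And>n. r n \<noteq> 0"
    and "\<And>n. t n \<noteq> 0"
    and "s 0 \<noteq> 0"
  shows "\<forall>X\<in>{l_infty, c_conv, c_null}. alpha_dual (mean_diff_space r s t X) = Lambda_set r s t"
proof
  fix X :: "(nat \<Rightarrow> 'a) set" assume "X \<in> {l_infty, c_conv, c_null}"
  then have X: "c_null \<subseteq> X" "X \<subseteq> l_infty"
    by (auto simp: l_infty_def c_conv_def c_null_def convergent_def
        intro: convergent_imp_Bseq[unfolded convergent_def])
  have "(\<forall>y\<in>X. (\<lambda>n. \<Sum>j\<le>n. inv_kernel r s t n j * a n * y j) \<in> l_one) \<longleftrightarrow>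
      bounded_subset_sums (\<lambda>n j. inv_kernel r s t n j * a n)" for a
  proof
    assume "\<forall>y\<in>X. (\<lambda>n. \<Sum>j\<le>n. inv_kernel r s t n j * a n * y j) \<in> l_one"
    then show "bounded_subset_sums (\<lambda>n j. inv_kernel r s t n j * a n)"
      using X(1) by (intro null_to_l_one_imp_bounded_subset_sums) (auto simp: inv_kernel_def c_null_def)
  next
    assume "bounded_subset_sums (\<lambda>n j. inv_kernel r s t n j * a n)"
    then show "\<forall>y\<in>X. (\<lambda>n. \<Sum>j\<le>n. inv_kernel r s t n j * a n * y j) \<in> l_one"
      using X(2) by (intro ballI bounded_subset_sums_imp_l_one) (auto simp: inv_kernel_def l_infty_def)
  qed
  moreover have "inv_kernel r s t n j * a n =
      (if j \<le> n then \<Sum>k\<le>n - j. (-1) ^ k * (D_num s k / t (k + j)) * r j * a n else 0)" for n j a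
    by (simp add: inv_kernel_def sum_distrib_right)
  ultimately show "alpha_dual (mean_diff_space r s t X) = Lambda_set r s t"
    unfolding alpha_dual_mean_diff_space[of r t s, OF assms] Lambda_set_def bounded_subset_sums_iff_SUP
    by simp
qed

end
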